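(* Consider the Markovian switched ODE $$\frac{dr}{dt}=\boldsymbol b^\gamma(\boldsymbol F(\theta(t)))\cdot\boldsymbol F(\theta(t))-F_{\min}(\theta(t))-r,$$ with $r(0)=r_0$ and $\theta(0)=\theta_0$, where $\theta(t)$ is a continuous-time Markov chain on $\mathcal Q$ with generator $Q$. For any $\eta>0$, there exists $\bar\gamma(\eta)>0$ such that, if $\gamma<\bar\gamma(\eta)$, the following results hold: 1) If $\theta(t)=\bar\theta$ is fixed, the resulting deterministic dynamical system is asymptotically stable: the set $\mathbb R_{[0,\eta)}=\{r\in\mathbb R: 0\le r<\eta\}$ is globally asymptotically stable for each $\bar\theta\in\mathcal Q$, i.e., $$\lim_{t\to\infty}d\big(r(t),\mathbb R_{[0,\eta)}\big)=0.$$ 2) For the Markovian switching ODE, the set $\mathbb R_{[0,\eta)}$ is globally asymptotically stable almost surely.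
   Context: $\mathcal M=\{1,\dots,S\}$, $\mathcal Q=\{1,\dots,\Theta\}$ are finite sets; $F:\mathcal M\times\mathcal Q\to\mathbb R$ is the (expected) objective function; $\boldsymbol F(\theta)=[F(1,\theta),\dots,F(S,\theta)]'$ and $F_{\min}(\theta)=\min_{s\in\mathcal M}F(s,\theta)$. $Q=[q_{ij}]\in\mathbb R^{\Theta\times\Theta}$ is an irreducible generator of a continuous-time Markov chain: $q_{ij}\ge0$ for $i\ne j$, $|q_{ij}|\le1$ for all $i,j\in\mathcal Q$, rows sum to zero. $\Delta\mathcal M=\{\boldsymbol p\in\mathbb R^S: p_i\ge 0,\ \sum_{i\in\mathcal M}p_i=1\}$. Fix a function $\rho:\mathrm{int}(\Delta\mathcal M)\to\mathbb R$ that is continuously differentiable, strictly concave, satisfies $|\rho|\le 1$, and $\|\nabla\rho(\boldsymbol\sigma)\|\to\infty$ as $\boldsymbol\sigma\to\partial(\Delta\mathcal M)$. For $\gamma>0$ and $\tilde{\boldsymbol f}\in\mathbb R^S$, the smooth best response is $$\boldsymbol b^\gamma(\tilde{\boldsymbol f}):=\arg\min_{\boldsymbol\sigma\in\Delta\mathcal M}\Big\{\sum_{i\in\mathcal M}\sigma_i\tilde f_i-\gamma\rho(\boldsymbol\sigma)\Big\}.$$ $d(\cdot,\cdot)$ is the usual distance function. For a Markovian switched system $\dot Y(t)=f(Y(t),\theta(t))$, $Y(0)=Y_0$, $\theta(0)=\theta_0$, with $f(\cdot,i)$ locally Lipschitz for each $i\in\mathcal Q$, a set $\mathcal H$ of pairs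 $(Y,\theta)$ is called asymptotically stable almost surely if $\lim_{t\to\infty}d\big((Y(t),\theta(t)),\mathcal H\big)=0$ a.s.; "globally" refers to arbitrary initial conditions. A set of values of $r$ such as $\mathbb R_{[0,\eta)}$ is identified with $\mathbb R_{[0,\eta)}\times\mathcal Q$. *)

theory Defs
  imports "HOL-Probability.Probability"
begin

(* The finite index set of the objective is a finite type 's, so that R^S is real ^ 's.  The states
   of the Markov chain are the naturals in {1..N}; pairs (Y, theta) are embedded in 'a * real, so that
   the distance to a set of pairs is the library's infdist. *)

section \<open>Smooth best response\<close>

definition prob_simplex :: "(real ^ 's::finite) set" where
  "prob_simplex = {p. (\<forall>i. 0 \<le> p $ i) \<and> (\<Sum>i\<in>UNIV. p $ i) = 1}"

(* The simplex has empty interior in R^S; int is the relative interior. *)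
abbreviation simplex_int :: "(real ^ 's::finite) set" where
  "simplex_int \<equiv> rel_interior prob_simplex"

(* Intrinsic gradient of a function living on the relative interior: the vector tangent to the
   simplex that represents the derivative along the simplex. *)
definition has_simplex_gradient :: "(real ^ 's::finite \<Rightarrow> real) \<Rightarrow> real ^ 's \<Rightarrow> real ^ 's \<Rightarrow> bool" where
  "has_simplex_gradient \<rho> g \<sigma> \<longleftrightarrow>
     (\<Sum>i\<in>UNIV. g $ i) = 0 \<and> (\<rho> has_derivative (\<lambda>h. g \<bullet> h)) (at \<sigma> within simplex_int)"

(* Only the values of \<rho> on simplex_int matter.  Blow-up "as \<sigma> tends to the boundary" is stated at
   each boundary point, which by compactness is the same as uniformly in the distance to it. *)
definition admissible_perturbation :: "(real ^ 's::finite \<Rightarrow> real) \<Rightarrow> bool" where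
  "admissible_perturbation \<rho> \<longleftrightarrow>
     (\<forall>x\<in>simplex_int. \<forall>y\<in>simplex_int. x \<noteq> y \<longrightarrow>
        (\<forall>u. 0 < u \<and> u < 1 \<longrightarrow> (1 - u) * \<rho> x + u * \<rho> y < \<rho> ((1 - u) *\<^sub>R x + u *\<^sub>R y))) \<and>
     (\<forall>\<sigma>\<in>simplex_int. \<bar>\<rho> \<sigma>\<bar> \<le> 1) \<and>
     (\<exists>g. (\<forall>\<sigma>\<in>simplex_int. has_simplex_gradient \<rho> (g \<sigma>) \<sigma>) \<and>
          continuous_on simplex_int g \<and>
          (\<forall>x\<in>rel_frontier prob_simplex.
             filterlim (\<lambda>\<sigma>. norm (g \<sigma>)) at_top (at x within simplex_int)))"

(* \<rho> is given on the relative interior only, whereas the best response minimises over the whole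
   simplex.  On the boundary we use the upper semicontinuous extension of \<rho> (for a bounded concave
   function on a polytope, this is its continuous extension). *)
definition simplex_extension :: "(real ^ 's::finite \<Rightarrow> real) \<Rightarrow> real ^ 's \<Rightarrow> real" where
  "simplex_extension \<rho> \<sigma> =
     (if \<sigma> \<in> simplex_int then \<rho> \<sigma>
      else real_of_ereal (Limsup (at \<sigma> within simplex_int) (\<lambda>s. ereal (\<rho> s))))"

definition smooth_best_response ::
    "(real ^ 's::finite \<Rightarrow> real) \<Rightarrow> real \<Rightarrow> real ^ 's \<Rightarrow> real ^ 's" where
  "smooth_best_response \<rho> \<gamma> f =
     arg_min_on (\<lambda>\<sigma>. (\<Sum>i\<in>UNIV. \<sigma> $ i * f $ i) - \<gamma> * simplex_extension \<rho> \<sigma>) prob_simplex"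

definition objective_vector :: "('s::finite \<Rightarrow> nat \<Rightarrow> real) \<Rightarrow> nat \<Rightarrow> real ^ 's" where
  "objective_vector F i = (\<chi> s. F s i)"

definition objective_min :: "('s::finite \<Rightarrow> nat \<Rightarrow> real) \<Rightarrow> nat \<Rightarrow> real" where
  "objective_min F i = Min (range (\<lambda>s. F s i))"

definition regret_drift ::
    "('s::finite \<Rightarrow> nat \<Rightarrow> real) \<Rightarrow> (real ^ 's \<Rightarrow> real) \<Rightarrow> real \<Rightarrow> real \<Rightarrow> nat \<Rightarrow> real" where
  "regret_drift F \<rho> \<gamma> r i =
     smooth_best_response \<rho> \<gamma> (objective_vector F i) \<bullet> objective_vector F i - objective_min F i - r"

section \<open>Continuous-time Markov chains on \<open>{1..N}\<close>\<close>

definition is_generator :: "nat \<Rightarrow> (nat \<Rightarrow> nat \<Rightarrow> real) \<Rightarrow> bool" where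
  "is_generator N q \<longleftrightarrow>
     (\<forall>i\<in>{1..N}. \<forall>j\<in>{1..N}. i \<noteq> j \<longrightarrow> 0 \<le> q i j) \<and>
     (\<forall>i\<in>{1..N}. \<forall>j\<in>{1..N}. \<bar>q i j\<bar> \<le> 1) \<and>
     (\<forall>i\<in>{1..N}. (\<Sum>j\<in>{1..N}. q i j) = 0)"

definition irreducible_generator :: "nat \<Rightarrow> (nat \<Rightarrow> nat \<Rightarrow> real) \<Rightarrow> bool" where
  "irreducible_generator N q \<longleftrightarrow>
     (\<forall>i\<in>{1..N}. \<forall>j\<in>{1..N}.
        (i, j) \<in> {(k, l). k \<in> {1..N} \<and> l \<in> {1..N} \<and> k \<noteq> l \<and> 0 < q k l}\<^sup>*)"

fun generator_power :: "nat \<Rightarrow> (nat \<Rightarrow> nat \<Rightarrow> real) \<Rightarrow> nat \<Rightarrow> nat \<Rightarrow> nat \<Rightarrow> real" where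
  "generator_power N q 0 i j = (if i = j then 1 else 0)"
| "generator_power N q (Suc n) i j = (\<Sum>k\<in>{1..N}. q i k * generator_power N q n k j)"

(* The (i, j) entry of the matrix exponential exp (t Q). *)
definition transition_function :: "nat \<Rightarrow> (nat \<Rightarrow> nat \<Rightarrow> real) \<Rightarrow> real \<Rightarrow> nat \<Rightarrow> nat \<Rightarrow> real" where
  "transition_function N q t i j = (\<Sum>n. t ^ n / fact n * generator_power N q n i j)"

(* Limits in nat are discrete, so the paths, which are right-continuous with left limits, are step
   functions with finitely many jumps in every bounded time interval. *)
definition markov_chain ::
    "'w measure \<Rightarrow> nat \<Rightarrow> (nat \<Rightarrow> nat \<Rightarrow> real) \<Rightarrow> nat \<Rightarrow> (real \<Rightarrow> 'w \<Rightarrow> nat) \<Rightarrow> bool" where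
  "markov_chain M N q \<theta>0 \<theta> \<longleftrightarrow>
     prob_space M \<and>
     (\<forall>t\<ge>0. \<theta> t \<in> measurable M (count_space {1..N})) \<and>
     (AE \<omega> in M. \<theta> 0 \<omega> = \<theta>0) \<and>
     (AE \<omega> in M. (\<forall>t\<ge>0. ((\<lambda>s. \<theta> s \<omega>) \<longlongrightarrow> \<theta> t \<omega>) (at_right t)) \<and>
                 (\<forall>t>0. \<exists>l. ((\<lambda>s. \<theta> s \<omega>) \<longlongrightarrow> l) (at_left t))) \<and>
     (\<forall>n \<tau> x. 0 \<le> \<tau> 0 \<and> (\<forall>k<n. \<tau> k \<le> \<tau> (Suc k)) \<and> (\<forall>k\<le>n. x k \<in> {1..N}) \<longrightarrow>
        measure M {\<omega> \<in> space M. \<forall>k\<le>n. \<theta> (\<tau> k) \<omega> = x k} =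
        measure M {\<omega> \<in> space M. \<theta> (\<tau> 0) \<omega> = x 0} *
        (\<Prod>k<n. transition_function N q (\<tau> (Suc k) - \<tau> k) (x k) (x (Suc k))))"

section \<open>Switched systems\<close>

(* The switching signal is piecewise constant: it is continuous at t exactly when t is not a
   switching time, and the differential equation is required at those t. *)
definition switched_solution ::
    "('a::real_normed_vector \<Rightarrow> nat \<Rightarrow> 'a) \<Rightarrow> (real \<Rightarrow> nat) \<Rightarrow> 'a \<Rightarrow> (real \<Rightarrow> 'a) \<Rightarrow> bool" where
  "switched_solution f \<theta> y0 y \<longleftrightarrow>
     y 0 = y0 \<and> continuous_on {0..} y \<and>
     (\<forall>t\<ge>0. continuous (at t within {0..}) \<theta> \<longrightarrow>
        (y has_vector_derivative f (y t) (\<theta> t)) (at t within {0..}))"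

definition globally_asymptotically_stable ::
    "('a::real_normed_vector \<Rightarrow> 'a) \<Rightarrow> 'a set \<Rightarrow> bool" where
  "globally_asymptotically_stable f H \<longleftrightarrow>
     (\<forall>y. (\<forall>t\<ge>0. (y has_vector_derivative f (y t)) (at t within {0..})) \<longrightarrow>
        ((\<lambda>t. infdist (y t) H) \<longlongrightarrow> 0) at_top)"

(* Global: over all initial conditions and all realisations of the chain and of the solution on M. *)
definition globally_asymptotically_stable_as ::
    "'w measure \<Rightarrow> nat \<Rightarrow> (nat \<Rightarrow> nat \<Rightarrow> real) \<Rightarrow>
     ('a::real_normed_vector \<Rightarrow> nat \<Rightarrow> 'a) \<Rightarrow> ('a \<times> nat) set \<Rightarrow> bool" where
  "globally_asymptotically_stable_as M N q f H \<longleftrightarrow>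
     (\<forall>\<theta>0\<in>{1..N}. \<forall>\<theta> Y0 Y.
        markov_chain M N q \<theta>0 \<theta> \<and>
        (AE \<omega> in M. switched_solution f (\<lambda>t. \<theta> t \<omega>) Y0 (\<lambda>t. Y t \<omega>)) \<longrightarrow>
        (AE \<omega> in M. ((\<lambda>t. infdist (Y t \<omega>, real (\<theta> t \<omega>)) (map_prod id real ` H)) \<longlongrightarrow> 0) at_top))"

end

theory Submission
  imports Defs "HOL-Real_Asymp.Real_Asymp"
begin

(* The payoff of the smooth best response exceeds the minimal payoff by an amount in [0, 2\<gamma>], because
   the extended perturbation is bounded by 1 and, being upper semicontinuous, lets the minimum be
   attained. So every mode is r' = c - r with 0 \<le> c \<le> 2\<gamma> < \<eta>. Along any step function, regardless of
   its law, exp t * r is nondecreasing and exp t * (r - 2\<gamma>) is nonincreasing, which squeezes r towards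
   [0, 2\<gamma>] exponentially fast. *)

section \<open>The smooth best response\<close>

text \<open>Weierstrass for lower semicontinuous functions. If every \<open>x\<close> could be
  improved to some \<open>t x\<close>, the open sets on which \<open>f\<close> exceeds
  \<open>f (t x)\<close> would cover \<open>S\<close>; a finite subcover then contradicts
  itself.\<close>

lemma compact_attains_inf_lsc:
  fixes f :: "'a::topological_space \<Rightarrow> real"
  assumes "compact S" "S \<noteq> {}"
    and lsc: "\<And>x c. x \<in> S \<Longrightarrow> c < f x \<Longrightarrow> \<exists>U. open U \<and> x \<in> U \<and> (\<forall>y\<in>U \<inter> S. c < f y)"
  shows "\<exists>x\<in>S. \<forall>y\<in>S. f x \<le> f y"
proof (rule ccontr)
  assume "\<not> ?thesis"
  then have "\<forall>x\<in>S. \<exists>y\<in>S. f y < f x"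
    by (meson not_le)
  then obtain t where t: "\<And>x. x \<in> S \<Longrightarrow> t x \<in> S \<and> f (t x) < f x"
    by metis
  then have "\<forall>x\<in>S. \<exists>U. open U \<and> x \<in> U \<and> (\<forall>y\<in>U \<inter> S. f (t x) < f y)"
    using lsc by blast
  then obtain U where U: "\<And>x. x \<in> S \<Longrightarrow> open (U x) \<and> x \<in> U x \<and> (\<forall>y\<in>U x \<inter> S. f (t x) < f y)"
    by metis
  obtain D where D: "D \<subseteq> S" "finite D" "S \<subseteq> (\<Union>x\<in>D. U x)"
    using compactE_image[OF \<open>compact S\<close>, of S U] U by blast
  have "D \<noteq> {}"
    using D \<open>S \<noteq> {}\<close> by auto
  \<comment> \<open>Take the centre of the finite subcover with the least improved value. The point
    \<open>t x\<close> lies in some \<open>U y\<close>, so \<open>f (t y)\<close> is smaller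
    still.\<close>
  then obtain x where x: "x \<in> D" "\<And>y. y \<in> D \<Longrightarrow> f (t x) \<le> f (t y)"
    using ex_min_if_finite[of "(\<lambda>x. f (t x)) ` D"] \<open>finite D\<close> by (auto simp: not_less)
  then have "t x \<in> S"
    using t D by blast
  then obtain y where "y \<in> D" "t x \<in> U y"
    using D by blast
  then have "f (t y) < f (t x)"
    using U \<open>t x \<in> S\<close> D by blast
  then show False
    using x \<open>y \<in> D\<close> by fastforce
qed

section \<open>Geometry of the probability simplex\<close>

lemma prob_simplex_nonneg: "p \<in> prob_simplex \<Longrightarrow> 0 \<le> p $ i"
  by (simp add: prob_simplex_def)

lemma prob_simplex_sum: "p \<in> prob_simplex \<Longrightarrow> (\<Sum>i\<in>UNIV. p $ i) = 1"
  by (simp add: prob_simplex_def)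

lemma axis_in_prob_simplex: "axis s 1 \<in> prob_simplex"
  by (simp add: prob_simplex_def axis_def)

lemma convex_prob_simplex: "convex prob_simplex"
  unfolding convex_def prob_simplex_def
  by (auto simp: sum.distrib simp flip: sum_distrib_left)

lemma compact_prob_simplex: "compact (prob_simplex :: (real ^ 's::finite) set)"
proof -
  have "closed (prob_simplex :: (real ^ 's) set)"
    unfolding prob_simplex_def
    by (intro closed_Collect_conj closed_Collect_all closed_Collect_le closed_Collect_eq
        continuous_intros)
  moreover have "p $ i \<le> 1" if "p \<in> prob_simplex" for p :: "real ^ 's" and i
    using member_le_sum[of i UNIV "\<lambda>i. p $ i"] that
    by (simp add: prob_simplex_nonneg prob_simplex_sum)
  then have "(prob_simplex :: (real ^ 's) set) \<subseteq> cbox 0 1"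
    by (auto simp: mem_box_cart prob_simplex_nonneg)
  ultimately show ?thesis
    by (meson bounded_cbox bounded_subset compact_eq_bounded_closed)
qed

section \<open>Boundary values of the perturbation\<close>

text \<open>A convex set lies in the closure of its relative interior, so boundary points are limit
  points of \<open>simplex_int\<close>. This keeps the \<open>Limsup\<close> in the extension from
  being taken over the trivial filter, where it would be minus infinity.\<close>

lemma at_within_simplex_int_neq_bot:
  assumes "x \<in> prob_simplex" "x \<notin> simplex_int"
  shows "at x within simplex_int \<noteq> bot"
proof -
  have "x \<in> closure simplex_int"
    using assms closure_subset convex_closure_rel_interior[OF convex_prob_simplex] by blast
  with assms show ?thesis
    by (simp add: closure_def trivial_limit_within)
qed

text \<open>The bound on \<open>\<rho>\<close> confines the extended-real \<open>Limsup\<close> to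
  [-1, 1]. It is therefore finite, and \<open>real_of_ereal\<close> returns its true value instead
  of the default 0.\<close>

lemma simplex_extension_boundary:
  assumes bnd: "\<And>\<sigma>. \<sigma> \<in> simplex_int \<Longrightarrow> \<bar>\<rho> \<sigma>\<bar> \<le> 1"
    and x: "x \<in> prob_simplex" "x \<notin> simplex_int"
  shows "ereal (simplex_extension \<rho> x) = Limsup (at x within simplex_int) (\<lambda>s. ereal (\<rho> s))"
    and "\<bar>simplex_extension \<rho> x\<bar> \<le> 1"
proof -
  let ?F = "at x within simplex_int"
  let ?L = "Limsup ?F (\<lambda>s. ereal (\<rho> s))"
  have nb: "?F \<noteq> bot"
    using x by (rule at_within_simplex_int_neq_bot)
  have ev: "eventually (\<lambda>s. s \<in> simplex_int) ?F"
    by (simp add: eventually_at_filter)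
  have "?L \<le> ereal 1"
    using ev bnd by (intro Limsup_bounded) (auto elim!: eventually_mono simp: abs_le_iff)
  moreover have "ereal (-1) \<le> ?L"
  proof (rule order_trans[OF _ Liminf_le_Limsup[OF nb]])
    show "ereal (-1) \<le> Liminf ?F (\<lambda>s. ereal (\<rho> s))"
      using ev by (intro Liminf_bounded, elim eventually_mono) (use bnd in force)
  qed
  ultimately obtain l where l: "?L = ereal l" "\<bar>l\<bar> \<le> 1"
    by (cases ?L) auto
  then show "ereal (simplex_extension \<rho> x) = ?L" "\<bar>simplex_extension \<rho> x\<bar> \<le> 1"
    using x by (simp_all add: simplex_extension_def)
qed

lemma abs_simplex_extension_le_1:
  assumes "\<And>\<sigma>. \<sigma> \<in> simplex_int \<Longrightarrow> \<bar>\<rho> \<sigma>\<bar> \<le> 1" "x \<in> prob_simplex"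
  shows "\<bar>simplex_extension \<rho> x\<bar> \<le> 1"
proof (cases "x \<in> simplex_int")
  case True
  with assms show ?thesis
    by (simp add: simplex_extension_def)
qed (rule simplex_extension_boundary(2)[OF assms])

text \<open>Near \<open>x\<close> the interior values stay below a level: by continuity if
  \<open>x\<close> is interior, by the definition of the \<open>Limsup\<close> otherwise. The bound
  then passes to neighbouring boundary points, whose values are themselves upper limits of interior
  values.\<close>

lemma simplex_extension_usc:
  assumes bnd: "\<And>\<sigma>. \<sigma> \<in> simplex_int \<Longrightarrow> \<bar>\<rho> \<sigma>\<bar> \<le> 1"
    and cont: "continuous_on simplex_int \<rho>"
    and x: "x \<in> prob_simplex" "simplex_extension \<rho> x < c"
  shows "\<exists>U. open U \<and> x \<in> U \<and> (\<forall>y\<in>U \<inter> prob_simplex. simplex_extension \<rho> y < c)"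
proof -
  \<comment> \<open>An intermediate level: at a neighbouring boundary point the upper limit turns
    \<open>< d\<close> into \<open>\<le> d\<close>, which still gives \<open>< c\<close>.\<close>
  obtain d where d: "simplex_extension \<rho> x < d" "d < c"
    using dense x by blast
  have "eventually (\<lambda>s. \<rho> s < d) (at x within simplex_int)"
  proof (cases "x \<in> simplex_int")
    case True
    then have "(\<rho> \<longlongrightarrow> \<rho> x) (at x within simplex_int)"
      using cont by (simp add: continuous_on_def)
    moreover have "\<rho> x < d"
      using d True by (simp add: simplex_extension_def)
    ultimately show ?thesis
      by (rule order_tendstoD)
  next
    case False
    have "Limsup (at x within simplex_int) (\<lambda>s. ereal (\<rho> s)) < ereal d"
      using d simplex_extension_boundary(1)[of \<rho>, OF bnd \<open>x \<in> prob_simplex\<close> False] by (metis less_ereal.simps(1))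
    then show ?thesis
      using Limsup_lessD by fastforce
  qed
  then obtain U where U: "open U" "x \<in> U" "\<And>s. s \<in> U \<Longrightarrow> s \<noteq> x \<Longrightarrow> s \<in> simplex_int \<Longrightarrow> \<rho> s < d"
    unfolding eventually_at_topological by blast
  have "simplex_extension \<rho> y < c" if y: "y \<in> U" "y \<in> prob_simplex" for y
  proof -
    consider "y = x" | "y \<noteq> x" "y \<in> simplex_int" | "y \<noteq> x" "y \<notin> simplex_int"
      by blast
    then show ?thesis
    proof cases
      case 1
      with x show ?thesis by simp
    next
      case 2
      with U y d show ?thesis
        by (force simp: simplex_extension_def)
    next
      case 3
      \<comment> \<open>The bound \<open>\<rho> s < d\<close> is known on \<open>U\<close> only away
        from \<open>x\<close>; since \<open>y \<noteq> x\<close>, the open set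
        \<open>U - {x}\<close> is still a neighbourhood of \<open>y\<close>.\<close>
      have "eventually (\<lambda>s. s \<in> U - {x}) (nhds y)"
        using U y 3 by (intro eventually_nhds_in_open) auto
      then have "eventually (\<lambda>s. ereal (\<rho> s) \<le> ereal d) (at y within simplex_int)"
        unfolding eventually_at_filter by eventually_elim (use U in force)
      then have "Limsup (at y within simplex_int) (\<lambda>s. ereal (\<rho> s)) \<le> ereal d"
        by (rule Limsup_bounded)
      then have "simplex_extension \<rho> y \<le> d"
        using simplex_extension_boundary(1)[of \<rho>, OF bnd y(2) 3(2)] by (metis ereal_less_eq(3))
      with d show ?thesis by simp
    qed
  qed
  with U show ?thesis
    by blast
qed

section \<open>Existence and regret of the smooth best response\<close>

text \<open>\<open>arg_min_on\<close> is a choice operator and says something only once a minimiser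
  exists. Subtracting a positive multiple of an upper semicontinuous function from a linear one
  leaves a lower semicontinuous cost, which attains its minimum on the compact simplex.\<close>

lemma smooth_best_response_arg_min:
  fixes \<rho> :: "real ^ 's::finite \<Rightarrow> real" and \<gamma> :: real and f :: "real ^ 's"
  defines "b \<equiv> smooth_best_response \<rho> \<gamma> f"
  assumes bnd: "\<And>\<sigma>. \<sigma> \<in> simplex_int \<Longrightarrow> \<bar>\<rho> \<sigma>\<bar> \<le> 1"
    and cont: "continuous_on simplex_int \<rho>" and "0 < \<gamma>"
  shows "b \<in> prob_simplex"
    and "\<sigma> \<in> prob_simplex \<Longrightarrow>
      b \<bullet> f - \<gamma> * simplex_extension \<rho> b \<le> \<sigma> \<bullet> f - \<gamma> * simplex_extension \<rho> \<sigma>"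
proof -
  define h where "h = (\<lambda>\<sigma>. \<sigma> \<bullet> f - \<gamma> * simplex_extension \<rho> \<sigma>)"
  have b: "b = arg_min_on h prob_simplex"
    by (simp add: b_def smooth_best_response_def h_def inner_vec_def)
  have lsc: "\<exists>U. open U \<and> x \<in> U \<and> (\<forall>y\<in>U \<inter> prob_simplex. c < h y)"
    if x: "x \<in> prob_simplex" "c < h x" for x c
  proof -
    \<comment> \<open>Half of the gap goes to each term: on \<open>U \<inter> V\<close> the linear
      part falls by less than \<open>e\<close>, and \<open>\<gamma>\<close> times the extension
      rises by less than \<open>e\<close>, whence the tolerance \<open>e / \<gamma>\<close> for the
      extension.\<close>
    define e where "e = (h x - c) / 2"
    have "e > 0"
      using x by (simp add: e_def)
    obtain U where U: "open U" "x \<in> U"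
      "\<And>y. y \<in> U \<Longrightarrow> y \<in> prob_simplex \<Longrightarrow> simplex_extension \<rho> y < simplex_extension \<rho> x + e / \<gamma>"
      using simplex_extension_usc[of \<rho>, OF bnd cont x(1), of "simplex_extension \<rho> x + e / \<gamma>"]
        \<open>e > 0\<close> \<open>0 < \<gamma>\<close> by auto
    define V where "V = {y. x \<bullet> f - e < y \<bullet> f}"
    have "open V"
      unfolding V_def by (intro open_Collect_less continuous_intros)
    moreover have "x \<in> V"
      using \<open>e > 0\<close> by (simp add: V_def)
    moreover have "c < h y" if "y \<in> U \<inter> V" "y \<in> prob_simplex" for y
    proof -
      have "\<gamma> * simplex_extension \<rho> y < \<gamma> * (simplex_extension \<rho> x + e / \<gamma>)"
        using U that \<open>0 < \<gamma>\<close> by (intro mult_strict_left_mono) auto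
      also have "\<dots> = \<gamma> * simplex_extension \<rho> x + e"
        using \<open>0 < \<gamma>\<close> by (simp add: field_simps)
      finally show ?thesis
        using that by (simp add: V_def h_def e_def field_simps)
    qed
    ultimately show ?thesis
      using U by (intro exI[of _ "U \<inter> V"]) auto
  qed
  have "\<exists>x\<in>prob_simplex. \<forall>y\<in>prob_simplex. h x \<le> h y"
    using axis_in_prob_simplex by (intro compact_attains_inf_lsc compact_prob_simplex lsc) auto
  then have "\<exists>x. is_arg_min h (\<lambda>x. x \<in> prob_simplex) x"
    by (auto simp: is_arg_min_linorder)
  then have "is_arg_min h (\<lambda>x. x \<in> prob_simplex) b"
    unfolding b arg_min_on_def arg_min_def by (rule someI_ex)
  then show "b \<in> prob_simplex"
    and "\<sigma> \<in> prob_simplex \<Longrightarrow>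
      b \<bullet> f - \<gamma> * simplex_extension \<rho> b \<le> \<sigma> \<bullet> f - \<gamma> * simplex_extension \<rho> \<sigma>"
    by (auto simp: is_arg_min_linorder h_def)
qed

text \<open>Upper bound: compare with the vertex of an optimal pure action, whose payoff is the
  minimum; the perturbation terms at the two points contribute at most \<open>\<gamma>\<close> each.
  Lower bound: an average is at least the minimum.\<close>

lemma smooth_best_response_regret_bounds:
  fixes \<rho> :: "real ^ 's::finite \<Rightarrow> real"
  assumes bnd: "\<And>\<sigma>. \<sigma> \<in> simplex_int \<Longrightarrow> \<bar>\<rho> \<sigma>\<bar> \<le> 1"
    and cont: "continuous_on simplex_int \<rho>" and "0 < \<gamma>"
  shows "smooth_best_response \<rho> \<gamma> (objective_vector F i) \<bullet> objective_vector F i - objective_min F i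
    \<in> {0..2 * \<gamma>}"
proof -
  define f where "f = objective_vector F i"
  define b where "b = smooth_best_response \<rho> \<gamma> f"
  have b: "b \<in> prob_simplex"
    using assms unfolding b_def by (intro smooth_best_response_arg_min)
  have "objective_min F i \<in> range (\<lambda>s. F s i)"
    unfolding objective_min_def by (intro Min_in) auto
  then obtain s where s: "objective_min F i = F s i"
    by auto
  have "axis s 1 \<bullet> f = objective_min F i"
    by (simp add: s inner_axis' f_def objective_vector_def)
  then have "b \<bullet> f - \<gamma> * simplex_extension \<rho> b \<le>
      objective_min F i - \<gamma> * simplex_extension \<rho> (axis s 1)"
    using smooth_best_response_arg_min(2)[of \<rho>, OF bnd cont \<open>0 < \<gamma>\<close> axis_in_prob_simplex, of f s]
    by (simp add: b_def)
  moreover have "\<bar>\<gamma> * simplex_extension \<rho> p\<bar> \<le> \<gamma>" if "p \<in> prob_simplex" for p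
    using mult_left_mono[OF abs_simplex_extension_le_1[of \<rho>, OF bnd that], of \<gamma>] \<open>0 < \<gamma>\<close>
    by (simp add: abs_mult)
  ultimately have upper: "b \<bullet> f - objective_min F i \<le> 2 * \<gamma>"
    using b axis_in_prob_simplex[of s] by (smt (verit))
  have "objective_min F i = (\<Sum>s\<in>UNIV. b $ s * objective_min F i)"
    using b by (simp add: prob_simplex_sum flip: sum_distrib_right)
  also have "\<dots> \<le> (\<Sum>s\<in>UNIV. b $ s * F s i)"
    using b by (intro sum_mono mult_left_mono) (auto simp: prob_simplex_nonneg objective_min_def)
  also have "\<dots> = b \<bullet> f"
    by (simp add: inner_vec_def f_def objective_vector_def)
  finally show ?thesis
    using upper by (simp add: b_def f_def)
qed

lemma admissible_perturbation_continuous_on: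
  assumes "admissible_perturbation \<rho>"
  shows "continuous_on simplex_int \<rho>"
  using assms unfolding admissible_perturbation_def has_simplex_gradient_def
  by (meson continuous_on_eq_continuous_within has_derivative_continuous)

section \<open>Relaxation along step functions\<close>

text \<open>Jump times need not be enumerated. Around each time there is a short interval on which
  \<open>\<theta>\<close> has one value to the left and one to the right, and Bolzano's bisection
  principle glues the local inequalities. Continuity of \<open>g\<close> carries them across the
  jumps.\<close>

lemma antimono_along_step_function:
  fixes g g' :: "real \<Rightarrow> real" and \<theta> :: "real \<Rightarrow> nat"
  assumes right: "\<And>t. 0 \<le> t \<Longrightarrow> (\<theta> \<longlongrightarrow> \<theta> t) (at_right t)"
    and left: "\<And>t. 0 < t \<Longrightarrow> \<exists>l. (\<theta> \<longlongrightarrow> l) (at_left t)"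
    and cont: "continuous_on {0..} g"
    and deriv: "\<And>t. 0 < t \<Longrightarrow> continuous (at t within {0..}) \<theta> \<Longrightarrow>
      (g has_real_derivative g' t) (at t) \<and> g' t \<le> 0"
    and "0 \<le> T"
  shows "g T \<le> g 0"
proof -
  \<comment> \<open>The derivative is needed only on the open interval, where a constant
    \<open>\<theta>\<close> is continuous; the endpoints may be jumps.\<close>
  have piece: "g b \<le> g a" if ab: "0 \<le> a" "a \<le> b" and const: "\<And>s. a < s \<Longrightarrow> s < b \<Longrightarrow> \<theta> s = k" for a b k
  proof (rule DERIV_nonpos_imp_decreasing_open[OF \<open>a \<le> b\<close>])
    show "continuous_on {a..b} g"
      using ab by (intro continuous_on_subset[OF cont]) auto
    fix s assume s: "a < s" "s < b"
    have "eventually (\<lambda>u. u \<in> {a<..<b}) (nhds s)"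
      using s by (intro eventually_nhds_in_open) auto
    then have "eventually (\<lambda>u. \<theta> u = \<theta> s) (at s within {0..})"
      unfolding eventually_at_filter by eventually_elim (use const s in auto)
    then have "continuous (at s within {0..}) \<theta>"
      unfolding continuous_within by (rule tendsto_eventually)
    then show "\<exists>y. (g has_real_derivative y) (at s) \<and> y \<le> 0"
      using deriv ab s by (intro exI[of _ "g' s"]) auto
  qed
  \<comment> \<open>The trivial premise is the guard \<open>0 \<le> a\<close> of the bisection
    predicate at \<open>a = 0\<close>: the local case also meets intervals starting left of 0, where
    nothing is known.\<close>
  have "0 \<le> (0::real) \<longrightarrow> g T \<le> g 0"
    using \<open>0 \<le> T\<close>
  proof (induction rule: Bolzano[where P = "\<lambda>a b. 0 \<le> a \<longrightarrow> g b \<le> g a"])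
    case (trans a b c)
    then show ?case by linarith
  next
    case (local t)
    have "eventually (\<lambda>s. \<theta> s = \<theta> t) (at_right t)"
      using right[OF \<open>0 \<le> t\<close>] by (simp add: tendsto_discrete)
    then obtain u where u: "u > t" "\<And>s. t < s \<Longrightarrow> s < u \<Longrightarrow> \<theta> s = \<theta> t"
      unfolding eventually_at_right_field by blast
    \<comment> \<open>The restriction to \<open>0 < s\<close> makes this vacuous at
      \<open>t = 0\<close>, where no left limit is available.\<close>
    have "\<exists>l v. v < t \<and> (\<forall>s. 0 < s \<longrightarrow> v < s \<longrightarrow> s < t \<longrightarrow> \<theta> s = l)"
    proof (cases "t = 0")
      case True
      then show ?thesis
        by (intro exI[of _ "-1"] exI[of _ 0]) auto
    next
      case False
      then obtain l where "(\<theta> \<longlongrightarrow> l) (at_left t)"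
        using left \<open>0 \<le> t\<close> by force
      then have "eventually (\<lambda>s. \<theta> s = l) (at_left t)"
        by (simp add: tendsto_discrete)
      then show ?thesis
        unfolding eventually_at_left_field by blast
    qed
    then obtain l v where v: "v < t" "\<And>s. 0 < s \<Longrightarrow> v < s \<Longrightarrow> s < t \<Longrightarrow> \<theta> s = l"
      by blast
    show ?case
    proof (intro exI conjI allI impI)
      show "0 < min (u - t) (t - v)"
        using u v by simp
      fix a b
      assume ab: "a \<le> t \<and> t \<le> b \<and> b - a < min (u - t) (t - v)" and "0 \<le> a"
      have "g t \<le> g a"
        by (rule piece[where k = l]) (use ab \<open>0 \<le> a\<close> v in auto)
      moreover have "g b \<le> g t"
        by (rule piece[where k = "\<theta> t"]) (use ab \<open>0 \<le> a\<close> u in auto)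
      ultimately show "g b \<le> g a"
        by simp
    qed
  qed
  then show ?thesis by simp
qed

text \<open>The integrating factor \<open>exp t\<close> cancels the \<open>- y\<close> in the
  equation: the derivative of \<open>exp t * (y t - C)\<close> is
  \<open>exp t * (c (\<theta> t) - C)\<close>, which is nonpositive in every mode.\<close>

lemma switched_relaxation_bounds:
  fixes \<theta> :: "real \<Rightarrow> nat" and y :: "real \<Rightarrow> real" and c :: "nat \<Rightarrow> real"
  assumes right: "\<And>t. 0 \<le> t \<Longrightarrow> (\<theta> \<longlongrightarrow> \<theta> t) (at_right t)"
    and left: "\<And>t. 0 < t \<Longrightarrow> \<exists>l. (\<theta> \<longlongrightarrow> l) (at_left t)"
    and sol: "switched_solution (\<lambda>r i. c i - r) \<theta> y0 y"
    and c: "\<And>i. m \<le> c i" "\<And>i. c i \<le> C" and "0 \<le> t"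
  shows "m + (y0 - m) * exp (- t) \<le> y t" and "y t \<le> C + (y0 - C) * exp (- t)"
proof -
  have y: "y 0 = y0" "continuous_on {0..} y"
    using sol by (auto simp: switched_solution_def)
  have dy: "(y has_real_derivative c (\<theta> s) - y s) (at s)"
    if "0 < s" "continuous (at s within {0..}) \<theta>" for s
  proof -
    have "(y has_vector_derivative c (\<theta> s) - y s) (at s within {0..})"
      using sol that by (auto simp: switched_solution_def)
    moreover have "at s within {0..} = at s"
      using that by (intro at_within_interior) simp
    ultimately show ?thesis
      by (simp add: has_real_derivative_iff_has_vector_derivative)
  qed
  have "exp t * (y t - C) \<le> exp 0 * (y 0 - C)"
  proof (rule antimono_along_step_function[OF right left _ _ \<open>0 \<le> t\<close>])
    show "continuous_on {0..} (\<lambda>t. exp t * (y t - C))"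
      by (intro continuous_intros y)
    fix s assume s: "0 < s" "continuous (at s within {0..}) \<theta>"
    have "((\<lambda>t. exp t * (y t - C)) has_real_derivative exp s * (c (\<theta> s) - C)) (at s)"
      by (rule derivative_eq_intros dy s refl)+ (simp add: algebra_simps)
    then show "((\<lambda>t. exp t * (y t - C)) has_real_derivative exp s * (c (\<theta> s) - C)) (at s) \<and>
        exp s * (c (\<theta> s) - C) \<le> 0"
      using c by (simp add: mult_nonneg_nonpos)
  qed
  then show "y t \<le> C + (y0 - C) * exp (- t)"
    by (simp add: y exp_minus field_simps)
  \<comment> \<open>The difference is reversed so that the lower bound, too, becomes a statement
    about a nonincreasing function.\<close>
  have "exp t * (m - y t) \<le> exp 0 * (m - y 0)"
  proof (rule antimono_along_step_function[OF right left _ _ \<open>0 \<le> t\<close>])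
    show "continuous_on {0..} (\<lambda>t. exp t * (m - y t))"
      by (intro continuous_intros y)
    fix s assume s: "0 < s" "continuous (at s within {0..}) \<theta>"
    have "((\<lambda>t. exp t * (m - y t)) has_real_derivative exp s * (m - c (\<theta> s))) (at s)"
      by (rule derivative_eq_intros dy s refl)+ (simp add: algebra_simps)
    then show "((\<lambda>t. exp t * (m - y t)) has_real_derivative exp s * (m - c (\<theta> s))) (at s) \<and>
        exp s * (m - c (\<theta> s)) \<le> 0"
      using c by (simp add: mult_nonneg_nonpos)
  qed
  then show "m + (y0 - m) * exp (- t) \<le> y t"
    by (simp add: y exp_minus field_simps)
qed

section \<open>Convergence to the target set\<close>

lemma switched_relaxation_infdist_tendsto_0:
  fixes \<theta> :: "real \<Rightarrow> nat" and y :: "real \<Rightarrow> real" and c :: "nat \<Rightarrow> real"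
  assumes right: "\<And>t. 0 \<le> t \<Longrightarrow> (\<theta> \<longlongrightarrow> \<theta> t) (at_right t)"
    and left: "\<And>t. 0 < t \<Longrightarrow> \<exists>l. (\<theta> \<longlongrightarrow> l) (at_left t)"
    and sol: "switched_solution (\<lambda>r i. c i - r) \<theta> y0 y"
    and c: "\<And>i. m \<le> c i" "\<And>i. c i \<le> C"
    and A: "{m..C} \<subseteq> A" and I: "\<And>t. 0 \<le> t \<Longrightarrow> \<theta> t \<in> I"
  shows "((\<lambda>t. infdist (y t, real (\<theta> t)) (map_prod id real ` (A \<times> I))) \<longlongrightarrow> 0) at_top"
proof (rule tendsto_sandwich[where f = "\<lambda>_. 0"])
  \<comment> \<open>The solution overshoots either end of the interval by at most
    \<open>exp (- t)\<close> times the initial distance to that end; the sum covers both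
    cases.\<close>
  define K where "K = \<bar>y0 - m\<bar> + \<bar>y0 - C\<bar>"
  show "((\<lambda>t. K * exp (- t)) \<longlongrightarrow> 0) at_top"
    by real_asymp
  show "eventually (\<lambda>t. infdist (y t, real (\<theta> t)) (map_prod id real ` (A \<times> I)) \<le> K * exp (- t)) at_top"
    using eventually_ge_at_top[of 0]
  proof eventually_elim
    case (elim t)
    \<comment> \<open>The projection of \<open>y t\<close> onto the interval from \<open>m\<close>
      to \<open>C\<close>. Pairing it with the current mode makes the second coordinate contribute
      nothing to the distance.\<close>
    define h where "h = max m (min C (y t))"
    have "m \<le> C"
      using c order_trans by blast
    then have "h \<in> A"
      using A by (auto simp: h_def)
    then have "infdist (y t, real (\<theta> t)) (map_prod id real ` (A \<times> I))
        \<le> dist (y t, real (\<theta> t)) (h, real (\<theta> t))"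
      using I[OF elim] by (intro infdist_le) force
    also have "\<dots> = \<bar>y t - h\<bar>"
      by (simp add: dist_Pair_Pair dist_real_def)
    also have "\<dots> \<le> K * exp (- t)"
    proof -
      have "m + (y0 - m) * exp (- t) \<le> y t" "y t \<le> C + (y0 - C) * exp (- t)"
        using switched_relaxation_bounds[OF right left sol c elim] by blast+
      moreover have "\<bar>(y0 - m) * exp (- t)\<bar> + \<bar>(y0 - C) * exp (- t)\<bar> = K * exp (- t)"
        by (simp add: K_def abs_mult distrib_right)
      ultimately show ?thesis
        using \<open>m \<le> C\<close> by (simp add: h_def)
    qed
    finally show ?case .
  qed
qed (auto simp: infdist_nonneg)

text \<open>A fixed mode is a switched system with constant signal. Taking \<open>m = C = c\<close>
  makes the two bounds coincide and yields the explicit solution.\<close>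

lemma relaxation_globally_asymptotically_stable:
  fixes c :: real
  assumes "c \<in> H"
  shows "globally_asymptotically_stable (\<lambda>r. c - r) H"
  unfolding globally_asymptotically_stable_def
proof (intro allI impI)
  fix y :: "real \<Rightarrow> real"
  assume y: "\<forall>t\<ge>0. (y has_vector_derivative c - y t) (at t within {0..})"
  then have "continuous_on {0..} y"
    by (auto simp: continuous_on_eq_continuous_within intro: has_vector_derivative_continuous)
  with y have sol: "switched_solution (\<lambda>r i. c - r) (\<lambda>_. 0) (y 0) y"
    by (simp add: switched_solution_def)
  have eq: "y t = c + (y 0 - c) * exp (- t)" if "0 \<le> t" for t
    using switched_relaxation_bounds[OF _ _ sol, of c c t] that by force
  show "((\<lambda>t. infdist (y t) H) \<longlongrightarrow> 0) at_top"
  proof (rule tendsto_sandwich[where f = "\<lambda>_. 0"])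
    show "((\<lambda>t. \<bar>y 0 - c\<bar> * exp (- t)) \<longlongrightarrow> 0) at_top"
      by real_asymp
    show "eventually (\<lambda>t. infdist (y t) H \<le> \<bar>y 0 - c\<bar> * exp (- t)) at_top"
      using eventually_ge_at_top[of 0]
    proof eventually_elim
      case (elim t)
      have "infdist (y t) H \<le> dist (y t) c"
        using assms by (rule infdist_le)
      also have "\<dots> = \<bar>y 0 - c\<bar> * exp (- t)"
        by (simp add: eq[OF elim] dist_real_def abs_mult)
      finally show ?case .
    qed
  qed (auto simp: infdist_nonneg)
qed

text \<open>The argument is pathwise: almost every path is right-continuous with left limits and
  solves the equation, and measurability into \<open>count_space {1..N}\<close> keeps it among the
  states, so the deterministic estimate applies to it.\<close>

lemma relaxation_globally_asymptotically_stable_as: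
  fixes c :: "nat \<Rightarrow> real"
  assumes c: "\<And>i. m \<le> c i" "\<And>i. c i \<le> C" and A: "{m..C} \<subseteq> A"
  shows "globally_asymptotically_stable_as M N q (\<lambda>r i. c i - r) (A \<times> {1..N})"
  unfolding globally_asymptotically_stable_as_def
proof (intro ballI allI impI, elim conjE)
  fix \<theta>0 \<theta> Y0 Y
  assume chain: "markov_chain M N q \<theta>0 \<theta>"
    and sol: "AE \<omega> in M. switched_solution (\<lambda>r i. c i - r) (\<lambda>t. \<theta> t \<omega>) Y0 (\<lambda>t. Y t \<omega>)"
  have range: "\<theta> t \<omega> \<in> {1..N}" if "0 \<le> t" "\<omega> \<in> space M" for t \<omega>
    using chain that measurable_space[of "\<theta> t" M "count_space {1..N}" \<omega>]
    by (auto simp: markov_chain_def)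
  have "AE \<omega> in M. (\<forall>t\<ge>0. ((\<lambda>s. \<theta> s \<omega>) \<longlongrightarrow> \<theta> t \<omega>) (at_right t)) \<and>
                 (\<forall>t>0. \<exists>l. ((\<lambda>s. \<theta> s \<omega>) \<longlongrightarrow> l) (at_left t))"
    using chain by (simp add: markov_chain_def)
  then show "AE \<omega> in M. ((\<lambda>t. infdist (Y t \<omega>, real (\<theta> t \<omega>))
      (map_prod id real ` (A \<times> {1..N}))) \<longlongrightarrow> 0) at_top"
    using sol AE_space[of M]
  proof eventually_elim
    case (elim \<omega>)
    with range show ?case
      by (intro switched_relaxation_infdist_tendsto_0[OF _ _ elim(2) c A]) blast+
  qed
qed

theorem mainTheorem4:
  fixes F :: "'s::finite \<Rightarrow> nat \<Rightarrow> real"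
    and N :: nat
    and q :: "nat \<Rightarrow> nat \<Rightarrow> real"
    and \<rho> :: "real ^ 's \<Rightarrow> real"
    and \<eta> :: real
  assumes "is_generator N q"
    and "irreducible_generator N q"
    and "admissible_perturbation \<rho>"
    and "0 < \<eta>"
  shows "\<exists>\<gamma>bar>0. \<forall>\<gamma>. 0 < \<gamma> \<and> \<gamma> < \<gamma>bar \<longrightarrow>
           (\<forall>\<theta>bar\<in>{1..N}.
              globally_asymptotically_stable (\<lambda>r. regret_drift F \<rho> \<gamma> r \<theta>bar) {0..<\<eta>}) \<and>
           (\<forall>M :: 'w measure.
              globally_asymptotically_stable_as M N q (regret_drift F \<rho> \<gamma>) ({0..<\<eta>} \<times> {1..N}))"
\<comment> \<open>With \<open>\<gamma> < \<eta> / 2\<close> the interval from 0 to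
  \<open>2 * \<gamma>\<close>, which contains the equilibria of all modes, lies inside the half-open
  target.\<close>
proof (intro exI[of _ "\<eta> / 2"] conjI allI impI ballI)
  show "0 < \<eta> / 2"
    using \<open>0 < \<eta>\<close> by simp
  fix \<gamma> :: real
  assume \<gamma>: "0 < \<gamma> \<and> \<gamma> < \<eta> / 2"
  define c where "c i = smooth_best_response \<rho> \<gamma> (objective_vector F i) \<bullet> objective_vector F i
      - objective_min F i" for i
  have drift: "regret_drift F \<rho> \<gamma> = (\<lambda>r i. c i - r)"
    by (simp add: regret_drift_def c_def fun_eq_iff)
  have "\<bar>\<rho> \<sigma>\<bar> \<le> 1" if "\<sigma> \<in> simplex_int" for \<sigma>
    using assms that by (simp add: admissible_perturbation_def)
  then have c: "c i \<in> {0..2 * \<gamma>}" for i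
    unfolding c_def using \<gamma> assms
    by (intro smooth_best_response_regret_bounds admissible_perturbation_continuous_on) auto
  show "globally_asymptotically_stable (\<lambda>r. regret_drift F \<rho> \<gamma> r i) {0..<\<eta>}" for i
    unfolding drift using c[of i] \<gamma> by (intro relaxation_globally_asymptotically_stable) auto
  show "globally_asymptotically_stable_as M N q (regret_drift F \<rho> \<gamma>) ({0..<\<eta>} \<times> {1..N})"
    for M :: "'w measure"
    unfolding drift using c \<gamma>
    by (intro relaxation_globally_asymptotically_stable_as[of 0 c "2 * \<gamma>"]) auto
qed

end
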